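(* Let $E$ be a linear relation on $\mathcal{H}$. Then the following are equivalent: (i) $E$ is super-idempotent, i.e. $E \subseteq E^2$; (ii) $E = P_{\ker(I-E),\, \ker E} \ \hat{+}\ (\{0\}\times \operatorname{mul} E)$; (iii) $\operatorname{ran}(I-E) = \ker E + \operatorname{mul} E$; (iv) $E \subseteq P_{\operatorname{ran} E,\, \ker E + \operatorname{mul} E}$. In this case, $\operatorname{dom} E = (\operatorname{ran} E \cap \operatorname{dom} E) + \ker E$.
   Context: $\mathcal{H}$ is a complex separable Hilbert space; "subspace" means linear subspace, not necessarily closed. A linear relation on $\mathcal{H}$ is a linear subspace $E \subseteq \mathcal{H}\times\mathcal{H}$, with $\operatorname{dom}E=\{x:(x,y)\in E \text{ for some } y\}$, $\operatorname{ran}E=\{y:(x,y)\in E\text{ for some }x\}$, $\ker E=\{x:(x,0)\in E\}$, $\operatorname{mul}E=\{y:(0,y)\in E\}$. Product: $ST=\{(x,y): (x,z)\in T,\ (z,y)\in S \text{ for some } z\}$, and $E^2=EE$. $I=\{(u,u):u\in\mathcal{H}\}$ and $I-E=\{(x,x-y):(x,y)\in E\}$. $T\,\hat{+}\,S$ denotes the sum of $T$ and $S$ as linear subspaces of $\mathcal{H}\times\mathcal{H}$. For subspaces $\mathcal{M},\mathcal{N}$ of $\mathcal{H}$, $P_{\mathcal{M},\mathcal{N}}:=\{(m+n,m): m\in\mathcal{M},\ n\in\mathcal{N}\}$ (a linear relation). *)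

theory Defs
  imports "HOL-Analysis.Analysis" "HOL-Library.Set_Algebras"
begin

section \<open>Complex Hilbert spaces\<close>

class complex_vector = ab_group_add +
  fixes scaleC :: "complex \<Rightarrow> 'a \<Rightarrow> 'a"  (infixr \<open>*\<^sub>C\<close> 75)
  assumes scaleC_add_right: "a *\<^sub>C (x + y) = a *\<^sub>C x + a *\<^sub>C y"
    and scaleC_add_left: "(a + b) *\<^sub>C x = a *\<^sub>C x + b *\<^sub>C x"
    and scaleC_scaleC: "a *\<^sub>C b *\<^sub>C x = (a * b) *\<^sub>C x"
    and scaleC_one: "1 *\<^sub>C x = x"

lemma vector_space_scaleC: "vector_space (scaleC :: complex \<Rightarrow> 'a::complex_vector \<Rightarrow> 'a)"
  by unfold_locales (simp_all add: scaleC_add_right scaleC_add_left scaleC_scaleC scaleC_one)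

instantiation prod :: (complex_vector, complex_vector) complex_vector
begin

definition scaleC_prod :: "complex \<Rightarrow> 'a \<times> 'b \<Rightarrow> 'a \<times> 'b"
  where "scaleC_prod c p = (c *\<^sub>C fst p, c *\<^sub>C snd p)"

instance
  by standard (auto simp: scaleC_prod_def prod_eq_iff
      scaleC_add_right scaleC_add_left scaleC_scaleC scaleC_one)

end

text \<open>
  The norm, the metric and the topology come from the underlying real inner product space
  with inner product \<open>Re (cinner x y)\<close>, so that completeness and separability are those of
  the norm \<open>sqrt (Re (cinner x x))\<close>. The inner product \<open>cinner\<close> is linear in its first argument.
  Its positive definiteness is inherited from \<open>real_inner\<close>.
\<close>

class complex_hilbert_space = complex_vector + real_inner + complete_space +
  fixes cinner :: "'a \<Rightarrow> 'a \<Rightarrow> complex"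
  assumes scaleR_scaleC: "r *\<^sub>R x = complex_of_real r *\<^sub>C x"
    and cinner_commute: "cinner x y = cnj (cinner y x)"
    and cinner_add_left: "cinner (x + y) z = cinner x z + cinner y z"
    and cinner_scaleC_left: "cinner (c *\<^sub>C x) y = c * cinner x y"
    and inner_eq_Re_cinner: "inner x y = Re (cinner x y)"

class separable_complex_hilbert_space = complex_hilbert_space +
  assumes separable: "\<exists>D. countable D \<and> (\<forall>U. open U \<and> U \<noteq> {} \<longrightarrow> D \<inter> U \<noteq> {})"

text \<open>The classes are inhabited: \<open>complex\<close> is the one-dimensional example.\<close>

instantiation complex :: separable_complex_hilbert_space
begin

definition scaleC_complex :: "complex \<Rightarrow> complex \<Rightarrow> complex"
  where "scaleC_complex c x = c * x"

definition cinner_complex :: "complex \<Rightarrow> complex \<Rightarrow> complex"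
  where "cinner_complex x y = x * cnj y"

instance
proof
  show "\<exists>D::complex set. countable D \<and> (\<forall>U. open U \<and> U \<noteq> {} \<longrightarrow> D \<inter> U \<noteq> {})"
    using countable_dense_exists by (metis disjoint_iff)
qed (auto simp: scaleC_complex_def cinner_complex_def algebra_simps scaleR_conv_of_real
      inner_complex_def)

end


section \<open>Linear relations\<close>

definition linear_relation :: "('a::complex_vector \<times> 'a) set \<Rightarrow> bool"
  where "linear_relation E \<longleftrightarrow> module.subspace scaleC E"

text \<open>
  The domain and the range of \<open>E\<close> are \<^const>\<open>Domain\<close> and \<^const>\<open>Range\<close>. The product \<open>S T\<close>
  (first \<open>T\<close>, then \<open>S\<close>) is \<open>T O S\<close>. Sums of subspaces, of the space or of its square, are the
  elementwise sums of \<^theory>\<open>HOL-Library.Set_Algebras\<close>.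
\<close>

definition ker_rel :: "('a::zero \<times> 'a) set \<Rightarrow> 'a set"
  where "ker_rel E = {x. (x, 0) \<in> E}"

definition mul_rel :: "('a::zero \<times> 'a) set \<Rightarrow> 'a set"
  where "mul_rel E = {y. (0, y) \<in> E}"

definition id_minus_rel :: "('a::minus \<times> 'a) set \<Rightarrow> ('a \<times> 'a) set"
  where "id_minus_rel E = {(x, x - y) | x y. (x, y) \<in> E}"

definition P_rel :: "'a::plus set \<Rightarrow> 'a set \<Rightarrow> ('a \<times> 'a) set"
  where "P_rel M N = {(m + n, m) | m n. m \<in> M \<and> n \<in> N}"

definition super_idempotent :: "('a \<times> 'a) set \<Rightarrow> bool"
  where "super_idempotent E \<longleftrightarrow> E \<subseteq> E O E"

end

theory Submission
  imports Defs
begin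

text \<open>
  Each of the four conditions says that \<open>x - y \<in> ker E + mul E\<close> whenever \<open>(x, y) \<in> E\<close>. Indeed,
  if \<open>(x, y) \<in> E\<close> and \<open>x - y = k + m\<close> with \<open>k \<in> ker E\<close>, \<open>m \<in> mul E\<close>, then \<open>z = x - k = y + m\<close>
  satisfies \<open>(x, z), (z, z), (z, y) \<in> E\<close>; conversely, if \<open>(x, y), (x, z), (z, y) \<in> E\<close>, then
  \<open>x - z \<in> ker E\<close> and \<open>z - y \<in> mul E\<close>.
\<close>

lemma
  assumes "linear_relation E"
  shows linear_relation_zero: "(0, 0) \<in> E"
    and linear_relation_add: "(x, y) \<in> E \<Longrightarrow> (x', y') \<in> E \<Longrightarrow> (x + x', y + y') \<in> E"
    and linear_relation_diff: "(x, y) \<in> E \<Longrightarrow> (x', y') \<in> E \<Longrightarrow> (x - x', y - y') \<in> E"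
proof -
  interpret vector_space "scaleC :: complex \<Rightarrow> 'a \<times> 'a \<Rightarrow> 'a \<times> 'a"
    by (rule vector_space_scaleC)
  have E: "subspace E"
    using assms by (simp add: linear_relation_def)
  show "(0, 0) \<in> E"
    using subspace_0[OF E] by (simp add: zero_prod_def)
  show "(x + x', y + y') \<in> E" if "(x, y) \<in> E" "(x', y') \<in> E"
    using subspace_add[OF E that] by simp
  show "(x - x', y - y') \<in> E" if "(x, y) \<in> E" "(x', y') \<in> E"
    using subspace_diff[OF E that] by simp
qed

lemma mem_ker_id_minus_rel_iff:
  fixes E :: "('a::ab_group_add \<times> 'a) set"
  shows "x \<in> ker_rel (id_minus_rel E) \<longleftrightarrow> (x, x) \<in> E"
  by (auto simp: ker_rel_def id_minus_rel_def)

lemma mem_ker_plus_mul_iff: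
  "x \<in> ker_rel E + mul_rel E \<longleftrightarrow> (\<exists>k m. x = k + m \<and> (k, 0) \<in> E \<and> (0, m) \<in> E)"
  by (auto simp: set_plus_def ker_rel_def mul_rel_def)

text \<open>Resolves the right-hand side of (ii) into sums \<open>(u, u) + (k, 0) + (0, m)\<close>
  of a diagonal, a kernel and a multivalued-part pair, each of them lying in
  \<open>E\<close>.\<close>

lemma mem_P_rel_plus_mul_iff:
  fixes E :: "('a::ab_group_add \<times> 'a) set"
  shows "(x, y) \<in> P_rel (ker_rel (id_minus_rel E)) (ker_rel E) + ({0} \<times> mul_rel E) \<longleftrightarrow>
    (\<exists>u k m. x = u + k \<and> y = u + m \<and> (u, u) \<in> E \<and> (k, 0) \<in> E \<and> (0, m) \<in> E)"
    (is "_ \<longleftrightarrow> ?R")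
proof
  assume ?R
  then obtain u k m where x: "x = u + k" and y: "y = u + m"
    and "u \<in> ker_rel (id_minus_rel E)" "k \<in> ker_rel E" "m \<in> mul_rel E"
    unfolding mem_ker_id_minus_rel_iff by (auto simp: ker_rel_def mul_rel_def)
  then have "(u + k, u) + (0, m) \<in> P_rel (ker_rel (id_minus_rel E)) (ker_rel E) + ({0} \<times> mul_rel E)"
    by (intro set_plus_intro) (auto simp: P_rel_def)
  then show "(x, y) \<in> P_rel (ker_rel (id_minus_rel E)) (ker_rel E) + ({0} \<times> mul_rel E)"
    using x y by simp
next
  assume "(x, y) \<in> P_rel (ker_rel (id_minus_rel E)) (ker_rel E) + ({0} \<times> mul_rel E)"
  then obtain u k m where "x = u + k" "y = u + m"
    and "u \<in> ker_rel (id_minus_rel E)" "k \<in> ker_rel E" "m \<in> mul_rel E"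
    by (auto elim!: set_plus_elim simp: P_rel_def)
  then show ?R
    unfolding mem_ker_id_minus_rel_iff by (auto simp: ker_rel_def mul_rel_def)
qed

text \<open>One \<open>z\<close> serves three purposes: intermediate point of \<open>E O E\<close>,
  diagonal component in (ii), and common point of range and domain in the final claim.\<close>

lemma diff_mem_ker_plus_mul_obtain:
  assumes E: "linear_relation E" and xy: "(x, y) \<in> E" and "x - y \<in> ker_rel E + mul_rel E"
  obtains z where "(x - z, 0) \<in> E" "(0, z - y) \<in> E" "(x, z) \<in> E" "(z, y) \<in> E" "(z, z) \<in> E"
proof -
  obtain k m where km: "x - y = k + m" and k: "(k, 0) \<in> E" and m: "(0, m) \<in> E"
    using assms(3) by (auto simp: mem_ker_plus_mul_iff)
  have z: "x - k = y + m"
    using km by (simp add: algebra_simps)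
  have "(x - k, y) \<in> E"
    using linear_relation_diff[OF E xy k] by simp
  moreover have "(x, y + m) \<in> E"
    using linear_relation_add[OF E xy m] by simp
  \<comment> \<open>Adding \<open>(0, m)\<close> to \<open>(x - k, y)\<close>, which is
    \<open>calculation(1)\<close>, yields a diagonal pair, because
    \<open>x - k = y + m\<close>.\<close>
  moreover have "(x - k, y + m) \<in> E"
    using linear_relation_add[OF E calculation(1) m] by simp
  moreover have "x - (x - k) = k" "(y + m) - y = m"
    by simp_all
  ultimately show thesis
    using that[of "y + m"] k m unfolding z by simp
qed

lemma super_idempotent_iff_diff_mem:
  assumes E: "linear_relation E"
  shows "super_idempotent E \<longleftrightarrow> (\<forall>(x, y) \<in> E. x - y \<in> ker_rel E + mul_rel E)" (is "_ \<longleftrightarrow> ?D")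
proof
  assume super: "super_idempotent E"
  show ?D
  proof safe
    fix x y assume xy: "(x, y) \<in> E"
    then obtain z where "(x, z) \<in> E" "(z, y) \<in> E"
      using super by (auto simp: super_idempotent_def)
    \<comment> \<open>Subtracting pairs of \<open>E\<close> that share a coordinate cancels it:
      \<open>(x, y) - (z, y)\<close> and \<open>(x, z) - (x, y)\<close>.\<close>
    then have "(x - z, 0) \<in> E" "(0, z - y) \<in> E"
      using linear_relation_diff[OF E xy, of z y] linear_relation_diff[OF E _ xy, of x z] by auto
    moreover have "x - y = (x - z) + (z - y)"
      by simp
    ultimately show "x - y \<in> ker_rel E + mul_rel E"
      unfolding mem_ker_plus_mul_iff by blast
  qed
next
  assume D: ?D
  show "super_idempotent E"
    unfolding super_idempotent_def
  proof (rule subrelI)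
    fix x y assume xy: "(x, y) \<in> E"
    then have "x - y \<in> ker_rel E + mul_rel E"
      using D by blast
    then show "(x, y) \<in> E O E"
      using diff_mem_ker_plus_mul_obtain[OF E xy] by blast
  qed
qed

text \<open>The inclusion of the right-hand side in \<open>E\<close> is automatic, since all three
  summands of its elements lie in \<open>E\<close>. The other inclusion uses
  \<open>(x, y) = (z, z) + (x - z, 0) + (0, y - z)\<close>.\<close>

lemma eq_P_rel_plus_mul_iff_diff_mem:
  assumes E: "linear_relation E"
  shows "E = P_rel (ker_rel (id_minus_rel E)) (ker_rel E) + ({0} \<times> mul_rel E) \<longleftrightarrow>
    (\<forall>(x, y) \<in> E. x - y \<in> ker_rel E + mul_rel E)" (is "E = ?Q \<longleftrightarrow> ?D")
proof
  assume Q: "E = ?Q"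
  show ?D
  proof safe
    fix x y assume "(x, y) \<in> E"
    then have "(x, y) \<in> ?Q"
      using Q by simp
    then obtain u k m where "x = u + k" "y = u + m" "(k, 0) \<in> E" "(0, m) \<in> E"
      unfolding mem_P_rel_plus_mul_iff by blast
    \<comment> \<open>Here \<open>x - y = k - m\<close>, so the sign of \<open>m\<close> has to be
      moved into the multivalued part.\<close>
    moreover from this have "x - y = k + - m" "(0, - m) \<in> E"
      using linear_relation_diff[OF E linear_relation_zero[OF E], of 0 m] by auto
    ultimately show "x - y \<in> ker_rel E + mul_rel E"
      unfolding mem_ker_plus_mul_iff by blast
  qed
next
  assume D: ?D
  show "E = ?Q"
  proof (intro equalityI subrelI)
    fix x y assume xy: "(x, y) \<in> E"
    then have "x - y \<in> ker_rel E + mul_rel E"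
      using D by blast
    then obtain z where z: "(z, z) \<in> E" "(x - z, 0) \<in> E" "(0, z - y) \<in> E"
      using diff_mem_ker_plus_mul_obtain[OF E xy] by blast
    moreover have "(0, y - z) \<in> E"
      using linear_relation_diff[OF E linear_relation_zero[OF E] z(3)] by simp
    moreover have "x = z + (x - z)" "y = z + (y - z)"
      by simp_all
    ultimately show "(x, y) \<in> ?Q"
      unfolding mem_P_rel_plus_mul_iff by blast
  next
    fix x y assume "(x, y) \<in> ?Q"
    then obtain u k m
      where "x = u + k" "y = u + m" "(u, u) \<in> E" "(k, 0) \<in> E" "(0, m) \<in> E"
      unfolding mem_P_rel_plus_mul_iff by blast
    then show "(x, y) \<in> E"
      using linear_relation_add[OF E linear_relation_add[OF E, of u u k 0], of 0 m] by simp
  qed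
qed

lemma Range_id_minus_rel: "Range (id_minus_rel E) = (\<lambda>(x, y). x - y) ` E"
  by (force simp: id_minus_rel_def)

text \<open>For every linear relation \<open>k + m\<close> is the difference of the coordinates of
  \<open>(k, - m)\<close>, a pair of \<open>E\<close>. Hence one inclusion is automatic, and the
  other one is the condition on differences.\<close>

lemma Range_id_minus_eq_iff_diff_mem:
  assumes E: "linear_relation E"
  shows "Range (id_minus_rel E) = ker_rel E + mul_rel E \<longleftrightarrow>
    (\<forall>(x, y) \<in> E. x - y \<in> ker_rel E + mul_rel E)"
proof -
  have "ker_rel E + mul_rel E \<subseteq> Range (id_minus_rel E)"
  proof
    fix w assume "w \<in> ker_rel E + mul_rel E"
    then obtain k m where w: "w = k + m" and "(k, 0) \<in> E" "(0, m) \<in> E"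
      unfolding mem_ker_plus_mul_iff by blast
    then have "(k, - m) \<in> E"
      using linear_relation_diff[OF E, of k 0 0 m] by simp
    then show "w \<in> Range (id_minus_rel E)"
      unfolding Range_id_minus_rel using w by (intro image_eqI[where x = "(k, - m)"]) simp_all
  qed
  then have "Range (id_minus_rel E) = ker_rel E + mul_rel E \<longleftrightarrow>
      Range (id_minus_rel E) \<subseteq> ker_rel E + mul_rel E"
    by (metis order_refl subset_antisym)
  also have "\<dots> \<longleftrightarrow> (\<forall>(x, y) \<in> E. x - y \<in> ker_rel E + mul_rel E)"
    unfolding Range_id_minus_rel image_subset_iff by (simp add: case_prod_unfold)
  finally show ?thesis .
qed

text \<open>The second coordinate \<open>y\<close> fixes the component in \<open>Range E\<close>, so
  \<open>x = y + (x - y)\<close> is the only possible decomposition.\<close>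

lemma subset_P_rel_Range_iff_diff_mem:
  fixes E :: "('a::ab_group_add \<times> 'a) set"
  shows "E \<subseteq> P_rel (Range E) N \<longleftrightarrow> (\<forall>(x, y) \<in> E. x - y \<in> N)"
proof -
  have "(x, y) \<in> P_rel (Range E) N \<longleftrightarrow> x - y \<in> N" if "(x, y) \<in> E" for x y
    using that by (force simp: P_rel_def)
  then show ?thesis
    by auto
qed

text \<open>Split \<open>x = z + (x - z)\<close> with the intermediate point \<open>z\<close>: it is
  in the range by \<open>(x, z)\<close> and in the domain by \<open>(z, y)\<close>, while
  \<open>x - z\<close> is in the kernel.\<close>

lemma super_idempotent_Domain_eq:
  assumes E: "linear_relation E" and super: "super_idempotent E"
  shows "Domain E = (Range E \<inter> Domain E) + ker_rel E"
proof (intro equalityI subsetI)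
  fix x assume "x \<in> Domain E"
  then obtain y where xy: "(x, y) \<in> E"
    by blast
  then have "x - y \<in> ker_rel E + mul_rel E"
    using super super_idempotent_iff_diff_mem[OF E] by blast
  then obtain z where z: "(x, z) \<in> E" "(z, y) \<in> E" "(x - z, 0) \<in> E"
    using diff_mem_ker_plus_mul_obtain[OF E xy] by blast
  then have "z + (x - z) \<in> (Range E \<inter> Domain E) + ker_rel E"
    by (intro set_plus_intro) (auto simp: ker_rel_def)
  then show "x \<in> (Range E \<inter> Domain E) + ker_rel E"
    by simp
next
  fix x assume "x \<in> (Range E \<inter> Domain E) + ker_rel E"
  then obtain z k y where "x = z + k" "(z, y) \<in> E" "(k, 0) \<in> E"
    by (auto simp: set_plus_def ker_rel_def)
  then show "x \<in> Domain E"
    using linear_relation_add[OF E, of z y k 0] by auto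
qed

theorem proposition3p13:
  fixes E :: "('a::separable_complex_hilbert_space \<times> 'a) set"
  assumes "linear_relation E"
  shows "(super_idempotent E \<longleftrightarrow>
            E = P_rel (ker_rel (id_minus_rel E)) (ker_rel E) + ({0} \<times> mul_rel E)) \<and>
         (super_idempotent E \<longleftrightarrow> Range (id_minus_rel E) = ker_rel E + mul_rel E) \<and>
         (super_idempotent E \<longleftrightarrow> E \<subseteq> P_rel (Range E) (ker_rel E + mul_rel E)) \<and>
         (super_idempotent E \<longrightarrow> Domain E = (Range E \<inter> Domain E) + ker_rel E)"
proof -
  \<comment> \<open>Rewriting turns every condition into the same statement about differences, so
    the equivalences become trivial.\<close>
  note diff_mem_iffs = super_idempotent_iff_diff_mem[OF assms] eq_P_rel_plus_mul_iff_diff_mem[OF assms]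
    Range_id_minus_eq_iff_diff_mem[OF assms] subset_P_rel_Range_iff_diff_mem
  show ?thesis
    using super_idempotent_Domain_eq[OF assms] by (simp only: diff_mem_iffs) blast
qed

end
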